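(* Let $Y$ be a separable Banach space over $\mathbb{K}$ ($\mathbb{K}=\mathbb{R}$ or $\mathbb{C}$). If $w^*\mathrm{QNA}(\ell_1,Y^* )=\mathcal{L}(\ell_1,Y^* )$, then $Y$ is finite dimensional.
   Context: Banach spaces (including $\ell_1$) are over the same scalar field $\mathbb{K}=\mathbb{R}$ or $\mathbb{C}$. $B_X$ is the closed unit ball of $X$, $X^*$ its topological dual, and $\mathcal{L}(X,Y)$ the space of bounded linear operators from $X$ to $Y$ with the operator norm. An operator $T\in\mathcal{L}(X,Y^* )$ weak-star quasi attains its norm, written $T\in w^*\mathrm{QNA}(X,Y^* )$, if the $\sigma(Y^*,Y)$-closure of $T(B_X)$ intersects the sphere $\{u^*\in Y^*:\|u^*\|=\|T\|\}$. *)

theory Defs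
  imports "HOL-Analysis.Analysis"
begin

text \<open>
  The library's normed spaces are real. A normed space over the field 'k (below: the reals or the
  complex numbers) is given by a real normed space together with a scalar multiplication by 'k
  that extends the real one and for which the norm is homogeneous. The norm, and hence the
  topology and completeness, are those of the underlying real space.
\<close>

locale normed_space_over = vector_space scale
  for scale :: "'k::real_normed_field \<Rightarrow> 'v::real_normed_vector \<Rightarrow> 'v" +
  assumes scale_of_real: "scale (of_real r) v = r *\<^sub>R v"
    and norm_scale: "norm (scale a v) = norm a * norm v"

lemma normed_space_over_scaleR:
  "normed_space_over ((*\<^sub>R) :: real \<Rightarrow> 'v::real_normed_vector \<Rightarrow> 'v)"
  by unfold_locales (auto simp: algebra_simps)

lemma normed_space_over_mult:
  "normed_space_over ((*) :: 'k \<Rightarrow> 'k \<Rightarrow> 'k::real_normed_field)"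
  by unfold_locales (auto simp: algebra_simps norm_mult scaleR_conv_of_real)

text \<open>
  The norm of the type of bounded real-linear maps is the operator norm, so the 'k-linear ones
  form the dual space, respectively the operator space, as normed subspaces.
\<close>

definition dual_space ::
    "('k::real_normed_field \<Rightarrow> 'y::real_normed_vector \<Rightarrow> 'y) \<Rightarrow> ('y \<Rightarrow>\<^sub>L 'k) set" where
  "dual_space sY = {f. \<forall>a y. blinfun_apply f (sY a y) = a * blinfun_apply f y}"

definition dual_scale :: "'k \<Rightarrow> ('y \<Rightarrow>\<^sub>L 'k) \<Rightarrow> ('y::real_normed_vector \<Rightarrow>\<^sub>L 'k::real_normed_field)" where
  "dual_scale a f = blinfun_mult_right a o\<^sub>L f"

lemma dual_scale_apply [simp]: "blinfun_apply (dual_scale a f) y = a * blinfun_apply f y"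
  by (simp add: dual_scale_def blinfun_mult_right.rep_eq)

definition operators_into_dual ::
    "('k::real_normed_field \<Rightarrow> 'x::real_normed_vector \<Rightarrow> 'x) \<Rightarrow>
     ('k \<Rightarrow> 'y::real_normed_vector \<Rightarrow> 'y) \<Rightarrow> ('x \<Rightarrow>\<^sub>L ('y \<Rightarrow>\<^sub>L 'k)) set" where
  "operators_into_dual sX sY =
     {T. (\<forall>x. blinfun_apply T x \<in> dual_space sY) \<and>
         (\<forall>a x. blinfun_apply T (sX a x) = dual_scale a (blinfun_apply T x))}"

text \<open>
  The coarsest topology on the dual space making all evaluations continuous (the topology on
  the function type is the product topology).
\<close>

definition weak_star_topology ::
    "('k::real_normed_field \<Rightarrow> 'y::real_normed_vector \<Rightarrow> 'y) \<Rightarrow> ('y \<Rightarrow>\<^sub>L 'k) topology" where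
  "weak_star_topology sY = pullback_topology (dual_space sY) blinfun_apply euclidean"

definition wstar_QNA ::
    "('k::real_normed_field \<Rightarrow> 'x::real_normed_vector \<Rightarrow> 'x) \<Rightarrow>
     ('k \<Rightarrow> 'y::real_normed_vector \<Rightarrow> 'y) \<Rightarrow> ('x \<Rightarrow>\<^sub>L ('y \<Rightarrow>\<^sub>L 'k)) set" where
  "wstar_QNA sX sY =
     {T \<in> operators_into_dual sX sY.
        weak_star_topology sY closure_of (blinfun_apply T ` cball 0 1) \<inter>
        {u \<in> dual_space sY. norm u = norm T} \<noteq> {}}"

typedef (overloaded) 'k ell1 = "{x :: nat \<Rightarrow> 'k::real_normed_field. summable (\<lambda>n. norm (x n))}"
  morphisms ell1_nth Abs_ell1
  by (rule exI[of _ "\<lambda>_. 0"]) simp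

setup_lifting type_definition_ell1

lift_definition ell1_scale :: "'k::real_normed_field \<Rightarrow> 'k ell1 \<Rightarrow> 'k ell1"
  is "\<lambda>a x n. a * x n"
  by (simp add: norm_mult summable_mult)

instantiation ell1 :: (real_normed_field) real_normed_vector
begin

lift_definition zero_ell1 :: "'a ell1" is "\<lambda>_. 0"
  by simp

lift_definition plus_ell1 :: "'a ell1 \<Rightarrow> 'a ell1 \<Rightarrow> 'a ell1" is "\<lambda>x y n. x n + y n"
  subgoal for x y
    by (rule summable_comparison_test'[OF summable_add[of "\<lambda>n. norm (x n)" "\<lambda>n. norm (y n)"]])
      (auto intro: norm_triangle_ineq)
  done

lift_definition uminus_ell1 :: "'a ell1 \<Rightarrow> 'a ell1" is "\<lambda>x n. - x n"
  by simp

lift_definition minus_ell1 :: "'a ell1 \<Rightarrow> 'a ell1 \<Rightarrow> 'a ell1" is "\<lambda>x y n. x n - y n"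
  subgoal for x y
    by (rule summable_comparison_test'[OF summable_add[of "\<lambda>n. norm (x n)" "\<lambda>n. norm (y n)"]])
      (auto intro: norm_triangle_ineq4)
  done

lift_definition scaleR_ell1 :: "real \<Rightarrow> 'a ell1 \<Rightarrow> 'a ell1" is "\<lambda>r x n. r *\<^sub>R x n"
  by (simp add: summable_mult)

lift_definition norm_ell1 :: "'a ell1 \<Rightarrow> real" is "\<lambda>x. \<Sum>n. norm (x n)" .

definition dist_ell1 :: "'a ell1 \<Rightarrow> 'a ell1 \<Rightarrow> real"
  where "dist_ell1 x y = norm (x - y)"

definition sgn_ell1 :: "'a ell1 \<Rightarrow> 'a ell1"
  where "sgn_ell1 x = inverse (norm x) *\<^sub>R x"

definition uniformity_ell1 :: "('a ell1 \<times> 'a ell1) filter"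
  where "uniformity_ell1 = (INF e\<in>{0 <..}. principal {(x, y). dist x y < e})"

definition open_ell1 :: "'a ell1 set \<Rightarrow> bool"
  where "open_ell1 S = (\<forall>x\<in>S. \<forall>\<^sub>F (x', y) in uniformity. x' = x \<longrightarrow> y \<in> S)"

instance
proof
  fix x y z :: "'a ell1" and r s :: real
  show "x + y + z = x + (y + z)" "x + y = y + x" "0 + x = x" "- x + x = 0" "x - y = x + - y"
    by (transfer, simp add: algebra_simps)+
  show "r *\<^sub>R (x + y) = r *\<^sub>R x + r *\<^sub>R y" "(r + s) *\<^sub>R x = r *\<^sub>R x + s *\<^sub>R x"
    "r *\<^sub>R s *\<^sub>R x = (r * s) *\<^sub>R x" "1 *\<^sub>R x = x"
    by (transfer, simp add: algebra_simps)+
  show "norm x = 0 \<longleftrightarrow> x = 0"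
    by transfer (auto simp: suminf_eq_zero_iff fun_eq_iff)
  show "norm (r *\<^sub>R x) = \<bar>r\<bar> * norm x"
    by transfer (simp add: suminf_mult)
  show "norm (x + y) \<le> norm x + norm y"
  proof transfer
    fix x y :: "nat \<Rightarrow> 'a"
    assume x: "summable (\<lambda>n. norm (x n))" and y: "summable (\<lambda>n. norm (y n))"
    have "summable (\<lambda>n. norm (x n + y n))"
      by (rule summable_comparison_test'[OF summable_add[OF x y]]) (auto intro: norm_triangle_ineq)
    then have "(\<Sum>n. norm (x n + y n)) \<le> (\<Sum>n. norm (x n) + norm (y n))"
      by (intro suminf_le summable_add x y norm_triangle_ineq)
    then show "(\<Sum>n. norm (x n + y n)) \<le> (\<Sum>n. norm (x n)) + (\<Sum>n. norm (y n))"
      by (simp add: suminf_add[OF x y])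
  qed
qed (simp_all add: dist_ell1_def sgn_ell1_def uniformity_ell1_def open_ell1_def)

end

lemma normed_space_over_ell1_scale:
  "normed_space_over (ell1_scale :: 'k \<Rightarrow> 'k ell1 \<Rightarrow> 'k::real_normed_field ell1)"
proof
  fix a b :: 'k and x y :: "'k ell1" and r :: real
  show "ell1_scale a (x + y) = ell1_scale a x + ell1_scale a y"
    "ell1_scale (a + b) x = ell1_scale a x + ell1_scale b x"
    "ell1_scale a (ell1_scale b x) = ell1_scale (a * b) x" "ell1_scale 1 x = x"
    by (transfer, simp add: algebra_simps)+
  show "ell1_scale (of_real r) x = r *\<^sub>R x"
    by transfer (simp add: scaleR_conv_of_real)
  show "norm (ell1_scale a x) = norm a * norm x"
    by transfer (simp add: norm_mult suminf_mult)
qed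

end

theory Submission
  imports Defs
begin

text \<open>
  If \<open>Y\<close> is separable and infinite dimensional, Hahn-Banach gives norm-one functionals \<open>f\<^sub>n\<close>
  vanishing on the first \<open>n\<close> points of a dense sequence, so \<open>f\<^sub>n\<close> is weak-star null. Let \<open>T\<close> send the
  \<open>n\<close>-th unit vector to \<open>c\<^sub>n f\<^sub>n\<close>, where \<open>c\<^sub>n < 1\<close> and \<open>c\<^sub>n\<close> tends to \<open>1\<close>; then \<open>T\<close> has norm \<open>1\<close>. The
  closed unit ball of \<open>\<ell>\<^sub>1\<close> is compact for coordinatewise convergence, and since \<open>c\<^sub>n f\<^sub>n\<close> is weak-star
  null, \<open>T\<close> is continuous from it to the weak-star topology. Hence \<open>T\<close> maps the ball onto a
  weak-star closed set, all of whose elements \<open>\<Sum>n. a\<^sub>n c\<^sub>n f\<^sub>n\<close> have norm at most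
  \<open>\<Sum>n. \<bar>a\<^sub>n\<bar> c\<^sub>n < 1\<close>.

  Hahn-Banach itself is obtained from the fact that a minimal sublinear functional is linear.
\<close>

subsection \<open>Sublinear functionals and separation\<close>

text \<open>Homogeneity is demanded only as an inequality for positive factors, which is easy to
  check for infima. Applying it to \<open>t\<close> and to \<open>inverse t\<close> gives
  equality.\<close>

definition sublinear :: "('v::real_vector \<Rightarrow> real) \<Rightarrow> bool" where
  "sublinear p \<longleftrightarrow> (\<forall>x y. p (x + y) \<le> p x + p y) \<and> (\<forall>t>0. \<forall>x. p (t *\<^sub>R x) \<le> t * p x)"

lemma sublinearI:
  assumes "\<And>x y. p (x + y) \<le> p x + p y" "\<And>t x. t > 0 \<Longrightarrow> p (t *\<^sub>R x) \<le> t * p x"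
  shows "sublinear p"
  using assms by (auto simp: sublinear_def)

lemma sublinear_add: "sublinear p \<Longrightarrow> p (x + y) \<le> p x + p y"
  by (auto simp: sublinear_def)

lemma sublinear_scaleR_le: "sublinear p \<Longrightarrow> t > 0 \<Longrightarrow> p (t *\<^sub>R x) \<le> t * p x"
  by (auto simp: sublinear_def)

lemma sublinear_zero:
  assumes "sublinear p"
  shows "p 0 = 0"
  using sublinear_scaleR_le[OF assms, of 2 0] sublinear_scaleR_le[OF assms, of "1/2" 0] by simp

lemma sublinear_scaleR:
  assumes "sublinear p" "t \<ge> 0"
  shows "p (t *\<^sub>R x) = t * p x"
proof (cases "t = 0")
  case False
  then have "t > 0" using assms by simp
  then have "p (inverse t *\<^sub>R (t *\<^sub>R x)) \<le> inverse t * p (t *\<^sub>R x)"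
    by (intro sublinear_scaleR_le assms) simp
  then have "t * p x \<le> p (t *\<^sub>R x)"
    using \<open>t > 0\<close> by (simp add: field_simps)
  then show ?thesis
    using sublinear_scaleR_le[OF assms(1) \<open>t > 0\<close>, of x] by simp
qed (simp add: sublinear_zero assms)

lemma sublinear_ge_minus:
  assumes "sublinear p"
  shows "- p (- x) \<le> p x"
  using sublinear_add[OF assms, of x "- x"] by (simp add: sublinear_zero assms)

text \<open>The largest sublinear functional below \<open>p\<close> whose value at \<open>- y\<close> is at most \<open>- p y\<close>.\<close>

definition tilt :: "'v \<Rightarrow> ('v::real_vector \<Rightarrow> real) \<Rightarrow> 'v \<Rightarrow> real" where
  "tilt y p x = (INF t\<in>{0..}. p (x + t *\<^sub>R y) - t * p y)"

lemma tilt_le: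
  assumes "sublinear p" "t \<ge> 0"
  shows "tilt y p x \<le> p (x + t *\<^sub>R y) - t * p y"
  unfolding tilt_def
proof (rule cINF_lower)
  show "bdd_below ((\<lambda>t. p (x + t *\<^sub>R y) - t * p y) ` {0..})"
  \<comment> \<open>The lower bound \<open>- p (- x)\<close>, uniform in the parameter, comes from
    writing \<open>s *\<^sub>R y\<close> as \<open>(x + s *\<^sub>R y) + - x\<close>.\<close>
  proof (rule bdd_belowI2)
    fix s :: real assume "s \<in> {0..}"
    then have "s * p y = p ((x + s *\<^sub>R y) + - x)"
      by (simp add: sublinear_scaleR assms(1))
    also have "\<dots> \<le> p (x + s *\<^sub>R y) + p (- x)"
      by (rule sublinear_add[OF assms(1)])
    finally show "- p (- x) \<le> p (x + s *\<^sub>R y) - s * p y"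
      by simp
  qed
qed (use assms in auto)

lemma tilt_greatest:
  assumes "\<And>t. t \<ge> 0 \<Longrightarrow> c \<le> p (x + t *\<^sub>R y) - t * p y"
  shows "c \<le> tilt y p x"
  unfolding tilt_def by (rule cINF_greatest) (use assms in auto)

lemma tilt_le_self: "sublinear p \<Longrightarrow> tilt y p x \<le> p x"
  using tilt_le[of p 0 y x] by simp

text \<open>Parameters \<open>s\<close> for \<open>x1\<close> and \<open>t\<close> for
  \<open>x2\<close> combine to the admissible parameter \<open>s + t\<close> for the sum; the two
  infima are then taken one after the other. Homogeneity comes from replacing \<open>t\<close> by
  \<open>c * t\<close>.\<close>

lemma sublinear_tilt:
  assumes "sublinear p"
  shows "sublinear (tilt y p)"
proof (rule sublinearI)
  fix x1 x2
  have "tilt y p (x1 + x2) - tilt y p x2 \<le> tilt y p x1"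
  proof (rule tilt_greatest)
    fix s :: real assume s: "s \<ge> 0"
    have "tilt y p (x1 + x2) - (p (x1 + s *\<^sub>R y) - s * p y) \<le> tilt y p x2"
    proof (rule tilt_greatest)
      fix t :: real assume t: "t \<ge> 0"
      have "tilt y p (x1 + x2) \<le> p ((x1 + x2) + (s + t) *\<^sub>R y) - (s + t) * p y"
        by (rule tilt_le) (use assms s t in auto)
      also have "(x1 + x2) + (s + t) *\<^sub>R y = (x1 + s *\<^sub>R y) + (x2 + t *\<^sub>R y)"
        by (simp add: algebra_simps)
      also have "p \<dots> \<le> p (x1 + s *\<^sub>R y) + p (x2 + t *\<^sub>R y)"
        by (rule sublinear_add[OF assms])
      finally show "tilt y p (x1 + x2) - (p (x1 + s *\<^sub>R y) - s * p y)
          \<le> p (x2 + t *\<^sub>R y) - t * p y"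
        by (simp add: algebra_simps)
    qed
    then show "tilt y p (x1 + x2) - tilt y p x2 \<le> p (x1 + s *\<^sub>R y) - s * p y"
      by simp
  qed
  then show "tilt y p (x1 + x2) \<le> tilt y p x1 + tilt y p x2"
    by simp
next
  fix c :: real and x assume c: "c > 0"
  have "tilt y p (c *\<^sub>R x) / c \<le> tilt y p x"
  proof (rule tilt_greatest)
    fix t :: real assume t: "t \<ge> 0"
    have "tilt y p (c *\<^sub>R x) \<le> p (c *\<^sub>R x + (c * t) *\<^sub>R y) - (c * t) * p y"
      by (rule tilt_le) (use assms c t in auto)
    also have "c *\<^sub>R x + (c * t) *\<^sub>R y = c *\<^sub>R (x + t *\<^sub>R y)"
      by (simp add: algebra_simps)
    also have "p \<dots> = c * p (x + t *\<^sub>R y)"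
      by (rule sublinear_scaleR) (use assms c in auto)
    finally show "tilt y p (c *\<^sub>R x) / c \<le> p (x + t *\<^sub>R y) - t * p y"
      using c by (simp add: field_simps)
  qed
  then show "tilt y p (c *\<^sub>R x) \<le> c * tilt y p x"
    using c by (simp add: field_simps)
qed

text \<open>Zorn's lemma for the reversed pointwise order: the pointwise infimum of a nonempty chain
  is again sublinear and below \<open>p\<close>.\<close>

lemma exists_minimal_sublinear:
  fixes p :: "'v::real_vector \<Rightarrow> real"
  assumes "sublinear p"
  obtains m where "sublinear m" "m \<le> p" "\<And>q. sublinear q \<Longrightarrow> q \<le> m \<Longrightarrow> q = m"
proof -
  define A where "A = {q :: 'v \<Rightarrow> real. sublinear q \<and> q \<le> p}"
  have "\<exists>m\<in>A. \<forall>a\<in>A. a \<le> m \<longrightarrow> a = m"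
  proof (rule predicate_Zorn)
    show "partial_order_on A (relation_of (\<lambda>q r. r \<le> q) A)"
      by (rule partial_order_on_relation_ofI) auto
  next
    fix C assume C: "C \<in> Chains (relation_of (\<lambda>q r :: 'v \<Rightarrow> real. r \<le> q) A)"
    then have CA: "C \<subseteq> A"
      by (rule Chains_relation_of)
    have total: "q \<le> r \<or> r \<le> q" if "q \<in> C" "r \<in> C" for q r
      using C that by (auto simp: Chains_def relation_of_def)
    show "\<exists>u\<in>A. \<forall>a\<in>C. u \<le> a"
    proof (cases "C = {}")
      case True
      then show ?thesis
        using assms by (auto simp: A_def)
    next
      case False
      define u where "u x = (INF q\<in>C. q x)" for x
      have subC: "sublinear q" if "q \<in> C" for q
        using that CA by (auto simp: A_def)
      have u_le: "u x \<le> q x" if "q \<in> C" for q x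
        unfolding u_def
      proof (rule cINF_lower[OF bdd_belowI2 that])
        \<comment> \<open>Every member of the chain lies below \<open>p\<close>, so
          \<open>- p (- x)\<close> bounds all their values at \<open>x\<close> from below and the
          infimum is finite.\<close>
        fix r assume "r \<in> C"
        then have "- p (- x) \<le> - r (- x)"
          using CA by (auto simp: A_def le_fun_def)
        also have "\<dots> \<le> r x"
          by (rule sublinear_ge_minus) (use subC \<open>r \<in> C\<close> in auto)
        finally show "- p (- x) \<le> r x" .
      qed
      have u_greatest: "c \<le> u x" if "\<And>q. q \<in> C \<Longrightarrow> c \<le> q x" for c x
        unfolding u_def by (rule cINF_greatest) (use False that in auto)
      have "sublinear u"
      proof (rule sublinearI)
        fix x y
        have "u (x + y) - u y \<le> u x"
        proof (rule u_greatest)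
          fix q assume q: "q \<in> C"
          have "u (x + y) - q x \<le> u y"
          proof (rule u_greatest)
            fix r assume r: "r \<in> C"
            \<comment> \<open>Subadditivity concerns one functional at a time; the chain condition
              replaces \<open>q\<close> and \<open>r\<close> by the smaller of the two.\<close>
            obtain s where s: "s \<in> C" "s \<le> q" "s \<le> r"
              using total[OF q r] q r by blast
            have "u (x + y) \<le> s (x + y)"
              by (rule u_le[OF s(1)])
            also have "\<dots> \<le> s x + s y"
              by (rule sublinear_add[OF subC[OF s(1)]])
            also have "\<dots> \<le> q x + r y"
              using s by (intro add_mono) (auto simp: le_fun_def)
            finally show "u (x + y) - q x \<le> r y" by simp
          qed
          then show "u (x + y) - u y \<le> q x" by simp
        qed
        then show "u (x + y) \<le> u x + u y" by simp
      next
        fix t :: real and x assume t: "t > 0"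
        have "u (t *\<^sub>R x) / t \<le> u x"
        proof (rule u_greatest)
          fix q assume q: "q \<in> C"
          have "u (t *\<^sub>R x) \<le> t * q x"
            using u_le[OF q, of "t *\<^sub>R x"] sublinear_scaleR_le[OF subC[OF q] t, of x] by simp
          then show "u (t *\<^sub>R x) / t \<le> q x"
            using t by (simp add: field_simps)
        qed
        then show "u (t *\<^sub>R x) \<le> t * u x"
          using t by (simp add: field_simps)
      qed
      moreover obtain q where "q \<in> C" "q \<le> p"
        using False CA by (auto simp: A_def)
      then have "u \<le> p"
        using u_le by (auto simp: le_fun_def intro: order_trans)
      ultimately show ?thesis
        using u_le by (intro bexI[of _ u]) (auto simp: A_def le_fun_def)
    qed
  qed
  then obtain m where "sublinear m" "m \<le> p" "\<And>a. sublinear a \<Longrightarrow> a \<le> p \<Longrightarrow> a \<le> m \<Longrightarrow> a = m"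
    by (auto simp: A_def)
  then show thesis
    by (intro that[of m]) (auto intro: order_trans)
qed

text \<open>Minimality forces \<open>tilt y m = m\<close>, and the parameter value 1 in the infimum
  then gives superadditivity.\<close>

lemma minimal_sublinear_imp_linear:
  assumes "sublinear m" and min: "\<And>q. sublinear q \<Longrightarrow> q \<le> m \<Longrightarrow> q = m"
  shows "linear m"
proof -
  have add: "m (x + y) = m x + m y" for x y
  proof (rule antisym)
    have "tilt y m = m"
      by (intro min sublinear_tilt assms) (auto simp: le_fun_def tilt_le_self assms)
    then show "m x + m y \<le> m (x + y)"
      using tilt_le[OF assms(1), of 1 y x] by simp
  qed (rule sublinear_add[OF assms(1)])
  have "m 0 = 0"
    by (rule sublinear_zero[OF assms(1)])
  then have neg: "m (- x) = - m x" for x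
    using add[of x "- x"] by simp
  show ?thesis
  proof (rule linearI)
    fix r x
    show "m (r *\<^sub>R x) = r *\<^sub>R m x"
    proof (cases "r \<ge> 0")
      case True
      then show ?thesis by (simp add: sublinear_scaleR assms(1))
    next
      case False
      then have "m (- (r *\<^sub>R x)) = - r * m x"
        using sublinear_scaleR[OF assms(1), of "- r" x] by simp
      then show ?thesis by (simp add: neg)
    qed
  qed (rule add)
qed

text \<open>Minimizing below \<open>tilt y p\<close> rather than below \<open>p\<close> secures
  equality at \<open>y\<close>: the parameter value 1 gives \<open>m (- y) \<le> - p y\<close>,
  which for linear \<open>m\<close> is the missing inequality.\<close>

theorem Hahn_Banach_sublinear:
  assumes "sublinear p"
  obtains f where "linear f" "\<And>x. f x \<le> p x" "f y = p y"
proof -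
  obtain m where m: "sublinear m" "m \<le> tilt y p" "\<And>q. sublinear q \<Longrightarrow> q \<le> m \<Longrightarrow> q = m"
    using exists_minimal_sublinear[OF sublinear_tilt[OF assms]] by blast
  have lin: "linear m"
    by (rule minimal_sublinear_imp_linear) (use m in auto)
  have le: "m x \<le> p x" for x
    using m(2) tilt_le_self[OF assms, of y x] by (auto simp: le_fun_def intro: order_trans)
  have "m (- y) \<le> tilt y p (- y)"
    using m(2) by (simp add: le_fun_def)
  also have "\<dots> \<le> - p y"
    using tilt_le[OF assms, of 1 y "- y"] by (simp add: sublinear_zero assms)
  finally have "m y = p y"
    using le[of y] by (simp add: linear_neg[OF lin])
  with lin le show thesis by (rule that)
qed

text \<open>Approximants in \<open>M\<close> may be added and rescaled without leaving
  \<open>M\<close>.\<close>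

lemma sublinear_infdist:
  fixes M :: "'v::real_normed_vector set"
  assumes "subspace M"
  shows "sublinear (\<lambda>x. infdist x M)"
proof -
  have ne: "M \<noteq> {}"
    using subspace_0[OF assms] by auto
  have greatest: "c \<le> infdist x M" if "\<And>a. a \<in> M \<Longrightarrow> c \<le> dist x a" for c x
    unfolding infdist_notempty[OF ne] by (rule cINF_greatest) (use ne that in auto)
  show ?thesis
  proof (rule sublinearI)
    fix x y
    have "infdist (x + y) M - infdist y M \<le> infdist x M"
    proof (rule greatest)
      fix a assume a: "a \<in> M"
      have "infdist (x + y) M - dist x a \<le> infdist y M"
      proof (rule greatest)
        fix b assume b: "b \<in> M"
        have "infdist (x + y) M \<le> dist (x + y) (a + b)"
          by (intro infdist_le subspace_add assms a b)
        also have "\<dots> \<le> dist x a + dist y b"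
          by (rule dist_triangle_add)
        finally show "infdist (x + y) M - dist x a \<le> dist y b" by simp
      qed
      then show "infdist (x + y) M - infdist y M \<le> dist x a" by simp
    qed
    then show "infdist (x + y) M \<le> infdist x M + infdist y M" by simp
  next
    fix t :: real and x assume t: "t > 0"
    have "infdist (t *\<^sub>R x) M / t \<le> infdist x M"
    proof (rule greatest)
      fix a assume a: "a \<in> M"
      have "infdist (t *\<^sub>R x) M \<le> dist (t *\<^sub>R x) (t *\<^sub>R a)"
        by (intro infdist_le subspace_scale assms a)
      also have "\<dots> = t * dist x a"
        using t by (simp add: dist_norm flip: scaleR_diff_right)
      finally show "infdist (t *\<^sub>R x) M / t \<le> dist x a"
        using t by (simp add: field_simps)
    qed
    then show "infdist (t *\<^sub>R x) M \<le> t * infdist x M"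
      using t by (simp add: field_simps)
  qed
qed

text \<open>Hahn-Banach is applied to the distance from \<open>M\<close>. It vanishes on
  \<open>M\<close>, is dominated by the norm because \<open>M\<close> contains 0, and is positive at
  \<open>y\<close> because \<open>M\<close> is closed.\<close>

theorem separate_point_closed_subspace:
  fixes M :: "'v::real_normed_vector set"
  assumes "subspace M" "closed M" "y \<notin> M"
  obtains f :: "'v \<Rightarrow> real" where "bounded_linear f" "\<And>x. x \<in> M \<Longrightarrow> f x = 0" "f y \<noteq> 0"
proof -
  obtain f where f: "linear f" "\<And>x. f x \<le> infdist x M" "f y = infdist y M"
    using Hahn_Banach_sublinear[OF sublinear_infdist[OF assms(1)]] by blast
  show thesis
  proof
    have "f x \<le> norm x" for x
      using f(2)[of x] infdist_le[OF subspace_0[OF assms(1)], of x] by simp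
    \<comment> \<open>The one-sided bound at \<open>- x\<close> supplies the other half of the
      absolute value.\<close>
    from this this[of "- _"] have "\<bar>f x\<bar> \<le> norm x" for x
      by (simp add: linear_neg[OF f(1)] abs_le_iff)
    then show "bounded_linear f"
      using f(1) by (intro bounded_linear_intro[where K = 1]) (auto simp: linear_add linear_scale)
    show "f x = 0" if "x \<in> M" for x
      using f(2)[of x] f(2)[of "- x"] that
      by (simp add: linear_neg[OF f(1)] subspace_neg[OF assms(1)])
    show "f y \<noteq> 0"
      using infdist_pos_not_in_closed[OF assms(2) _ assms(3)] subspace_0[OF assms(1)] f(3) by fastforce
  qed
qed

subsection \<open>The unit ball of the sequence space\<close>

lift_definition ell1_unit :: "nat \<Rightarrow> 'k::real_normed_field ell1" is "\<lambda>n i. if i = n then 1 else 0"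
  by (rule summable_finite[of "{_}"]) auto

lemma norm_ell1_unit [simp]: "norm (ell1_unit n) = 1"
  unfolding norm_ell1.rep_eq
  by (subst suminf_finite[of "{n}"]) (auto simp: ell1_unit.rep_eq)

lemma norm_dual_scale_le: "norm (dual_scale a f) \<le> norm a * norm f"
proof (rule norm_blinfun_bound)
  show "norm (dual_scale a f y) \<le> norm a * norm f * norm y" for y
    by (simp add: norm_mult mult.assoc mult_left_mono norm_blinfun)
qed simp

lemma summable_ell1_nth: "summable (\<lambda>n. norm (ell1_nth x n))"
  using ell1_nth[of x] by simp

text \<open>A bounded sequence of functionals prescribes the images of the unit vectors: the series
  defining \<open>S x\<close> converges absolutely in the dual norm, with sum of norm at most
  \<open>norm x * C\<close>.\<close>

lemma ell1_operator_exists: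
  fixes g :: "nat \<Rightarrow> 'y::real_normed_vector \<Rightarrow>\<^sub>L 'k::{real_normed_field,banach}"
  assumes dual: "\<And>n. g n \<in> dual_space sY" and bound: "\<And>n. norm (g n) \<le> C"
  obtains T where "T \<in> operators_into_dual ell1_scale sY" "norm T \<le> C"
    "\<And>x y. blinfun_apply (blinfun_apply T x) y = (\<Sum>n. ell1_nth x n * blinfun_apply (g n) y)"
proof -
  have C: "C \<ge> 0"
    using bound[of 0] norm_ge_zero order_trans by blast
  define S where "S x = (\<Sum>n. dual_scale (ell1_nth x n) (g n))" for x
  have le: "norm (dual_scale (ell1_nth x n) (g n)) \<le> norm (ell1_nth x n) * C" for x n
    by (rule order_trans[OF norm_dual_scale_le]) (simp add: bound mult_left_mono)
  have sum_norm: "summable (\<lambda>n. norm (dual_scale (ell1_nth x n) (g n)))" for x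
    by (rule summable_comparison_test'[OF summable_mult2[OF summable_ell1_nth[of x], of C]])
      (use le in auto)
  then have sum: "summable (\<lambda>n. dual_scale (ell1_nth x n) (g n))" for x
    by (rule summable_norm_cancel)
  have S_apply: "blinfun_apply (S x) y = (\<Sum>n. ell1_nth x n * blinfun_apply (g n) y)" for x y
    unfolding S_def
    using bounded_linear.suminf[OF blinfun.bounded_linear_left[of y] sum] by simp
  have sum_apply: "summable (\<lambda>n. ell1_nth x n * blinfun_apply (g n) y)" for x y
    using bounded_linear.summable[OF blinfun.bounded_linear_left[of y] sum] by simp
  have S_norm: "norm (S x) \<le> norm x * C" for x
  proof -
    have "norm (S x) \<le> (\<Sum>n. norm (dual_scale (ell1_nth x n) (g n)))"
      unfolding S_def by (rule summable_norm[OF sum_norm])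
    also have "\<dots> \<le> (\<Sum>n. norm (ell1_nth x n) * C)"
      by (intro suminf_le le sum_norm summable_mult2 summable_ell1_nth)
    also have "\<dots> = norm x * C"
      by (simp add: norm_ell1.rep_eq suminf_mult2[symmetric] summable_ell1_nth)
    finally show ?thesis .
  qed
  have S_scale: "S (ell1_scale a x) = dual_scale a (S x)" for a x
    by (rule blinfun_eqI)
      (simp add: S_apply ell1_scale.rep_eq mult.assoc suminf_mult sum_apply)
  have "bounded_linear S"
  proof (rule bounded_linear_intro)
    show "S (x + y) = S x + S y" for x y
      by (rule blinfun_eqI)
        (simp add: S_apply plus_ell1.rep_eq blinfun.add_left distrib_right suminf_add sum_apply)
    show "S (r *\<^sub>R x) = r *\<^sub>R S x" for r x
      by (rule blinfun_eqI)
        (simp add: S_apply scaleR_ell1.rep_eq blinfun.scaleR_left suminf_scaleR_right sum_apply)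
    show "norm (S x) \<le> norm x * C" for x
      by (rule S_norm)
  qed
  then have app: "blinfun_apply (Blinfun S) = S"
    by (rule bounded_linear_Blinfun_apply)
  show thesis
  proof
    show "Blinfun S \<in> operators_into_dual ell1_scale sY"
      using dual sum_apply
      by (auto simp: operators_into_dual_def app S_scale dual_space_def S_apply
          mult.left_commute suminf_mult)
    show "norm (Blinfun S) \<le> C"
      by (rule norm_blinfun_bound[OF C]) (simp only: app mult.commute[of C] S_norm)
    show "blinfun_apply (blinfun_apply (Blinfun S) x) y
        = (\<Sum>n. ell1_nth x n * blinfun_apply (g n) y)" for x y
      by (simp add: app S_apply)
  qed
qed

section \<open>Coordinatewise compactness of the ball and weak-star closed sets\<close>

definition ell1_ball :: "(nat \<Rightarrow> 'k::real_normed_field) set" where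
  "ell1_ball = {a. \<forall>N. (\<Sum>n<N. norm (a n)) \<le> 1}"

lemma ell1_ball_summable: "a \<in> ell1_ball \<Longrightarrow> summable (\<lambda>n. norm (a n))"
  by (rule bounded_imp_summable[of _ 1])
    (auto simp: ell1_ball_def simp del: sum.lessThan_Suc simp flip: lessThan_Suc_atMost)

lemma ell1_ball_suminf_le: "a \<in> ell1_ball \<Longrightarrow> (\<Sum>n. norm (a n)) \<le> 1"
  by (rule suminf_le_const[OF ell1_ball_summable]) (auto simp: ell1_ball_def)

lemma ell1_nth_in_ell1_ball: "norm x \<le> 1 \<Longrightarrow> ell1_nth x \<in> ell1_ball"
  unfolding ell1_ball_def norm_ell1.rep_eq
  by (auto intro: order_trans[OF sum_le_suminf[OF summable_ell1_nth]])

text \<open>By Tychonoff the product of closed scalar unit balls is compact. Each bound on a partial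
  sum involves finitely many coordinates, hence is a closed condition there.\<close>

lemma compact_ell1_ball:
  "compact (ell1_ball :: (nat \<Rightarrow> 'k::{real_normed_field,heine_borel}) set)"
proof -
  let ?P = "PiE UNIV (\<lambda>_::nat. cball (0::'k) 1)"
  have "compactin (product_topology (\<lambda>_. euclidean) UNIV) ?P"
    by (simp add: compactin_PiE)
  then have "compact ?P"
    by (simp add: euclidean_product_topology)
  moreover have "closed (\<Inter>N. {a :: nat \<Rightarrow> 'k. (\<Sum>n<N. norm (a n)) \<le> 1})"
    by (intro closed_INT ballI closed_Collect_le continuous_intros continuous_on_product_coordinates)
  moreover have "norm (a n) \<le> 1" if "a \<in> ell1_ball" for a :: "nat \<Rightarrow> 'k" and n
  proof -
    have "norm (a n) \<le> (\<Sum>i<Suc n. norm (a i))"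
      by (rule member_le_sum) auto
    also have "\<dots> \<le> 1"
      using that by (auto simp: ell1_ball_def simp del: sum.lessThan_Suc)
    finally show ?thesis .
  qed
  then have "ell1_ball = ?P \<inter> (\<Inter>N. {a :: nat \<Rightarrow> 'k. (\<Sum>n<N. norm (a n)) \<le> 1})"
    by (auto simp: ell1_ball_def)
  ultimately show ?thesis
    by (metis compact_Int_closed)
qed

text \<open>The tail beyond \<open>N\<close> is at most the supremum of the later
  \<open>norm (b n)\<close> times the total mass, which is at most 1 throughout the ball. Uniformity
  transfers continuity from the finite sums to the series.\<close>

lemma uniform_limit_null_sequence:
  fixes b :: "nat \<Rightarrow> 'k::{real_normed_field,banach}"
  assumes "b \<longlonglongrightarrow> 0"
  shows "uniform_limit ell1_ball (\<lambda>N a. \<Sum>n<N. a n * b n) (\<lambda>a. \<Sum>n. a n * b n) sequentially"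
proof (rule uniform_limitI)
  fix e :: real assume e: "e > 0"
  \<comment> \<open>Boundedness makes the series converge absolutely; smallness of the later terms
    controls the remainder.\<close>
  have "Bseq b"
    using assms by (intro convergent_imp_Bseq convergentI)
  then obtain K where K: "K > 0" "\<And>n. norm (b n) \<le> K"
    by (auto elim: BseqE)
  have "\<forall>\<^sub>F n in sequentially. norm (b n) < e / 2"
    using tendstoD[OF assms, of "e/2"] e by simp
  then obtain N0 where N0: "\<And>n. n \<ge> N0 \<Longrightarrow> norm (b n) < e / 2"
    by (auto simp: eventually_sequentially)
  have "dist (\<Sum>n<N. a n * b n) (\<Sum>n. a n * b n) < e"
    if N: "N \<ge> N0" and a: "a \<in> ell1_ball" for N a
  proof -
    note sa = ell1_ball_summable[OF a]
    have summ: "summable (\<lambda>n. norm (a n * b n))"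
      by (rule summable_comparison_test'[OF summable_mult2[OF sa, of K]])
        (use K in \<open>auto simp: norm_mult mult_left_mono\<close>)
    have "(\<Sum>n. a n * b n) = (\<Sum>n. a (n + N) * b (n + N)) + (\<Sum>n<N. a n * b n)"
      by (rule suminf_split_initial_segment[OF summable_norm_cancel[OF summ]])
    then have "dist (\<Sum>n<N. a n * b n) (\<Sum>n. a n * b n) = norm (\<Sum>n. a (n + N) * b (n + N))"
      by (simp add: dist_norm)
    also have "\<dots> \<le> (\<Sum>n. norm (a (n + N) * b (n + N)))"
      by (rule summable_norm[OF summable_ignore_initial_segment[OF summ]])
    also have "\<dots> \<le> (\<Sum>n. norm (a (n + N)) * (e / 2))"
    proof (intro suminf_le summable_mult2)
      show "norm (a (n + N) * b (n + N)) \<le> norm (a (n + N)) * (e / 2)" for n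
        unfolding norm_mult using N0[of "n + N"] N by (intro mult_left_mono) auto
      show "summable (\<lambda>n. norm (a (n + N) * b (n + N)))" "summable (\<lambda>n. norm (a (n + N)))"
        using summable_ignore_initial_segment[OF summ] summable_ignore_initial_segment[OF sa] by auto
    qed
    also have "\<dots> = (\<Sum>n. norm (a (n + N))) * (e / 2)"
      by (rule suminf_mult2[symmetric, OF summable_ignore_initial_segment[OF sa]])
    also have "(\<Sum>n. norm (a (n + N))) \<le> (\<Sum>n. norm (a n))"
      unfolding suminf_split_initial_segment[OF sa, of N] by (simp add: sum_nonneg)
    then have "(\<Sum>n. norm (a (n + N))) * (e / 2) \<le> 1 * (e / 2)"
      using ell1_ball_suminf_le[OF a] e by (intro mult_right_mono) auto
    also have "\<dots> < e" using e by simp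
    finally show ?thesis .
  qed
  then show "\<forall>\<^sub>F N in sequentially. \<forall>a\<in>ell1_ball. dist (\<Sum>n<N. a n * b n) (\<Sum>n. a n * b n) < e"
    by (auto simp: eventually_sequentially)
qed

text \<open>Each coordinate of the map is continuous on the compact ball, so the image is compact,
  hence closed in the Hausdorff product space.\<close>

lemma closed_null_sequence_combinations:
  fixes g :: "nat \<Rightarrow> 'y \<Rightarrow> 'k::{real_normed_field,banach,heine_borel}"
  assumes "\<And>y. (\<lambda>n. g n y) \<longlonglongrightarrow> 0"
  shows "closed ((\<lambda>a y. \<Sum>n. a n * g n y) ` ell1_ball)"
proof -
  have "compact ((\<lambda>a y. \<Sum>n. a n * g n y) ` ell1_ball)"
  proof (intro compact_continuous_image compact_ell1_ball continuous_on_coordinatewise_then_product)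
    show "continuous_on ell1_ball (\<lambda>a. \<Sum>n. a n * g n y)" for y
      by (rule uniform_limit_theorem[OF _ uniform_limit_null_sequence[OF assms]])
        (auto intro!: always_eventually continuous_intros continuous_on_product_coordinates
          continuous_on_subset[OF continuous_on_product_coordinates])
  qed
  moreover have "Hausdorff_space (euclidean :: ('y \<Rightarrow> 'k) topology)"
    unfolding euclidean_product_topology[symmetric] by (simp add: Hausdorff_space_product_topology)
  ultimately show ?thesis
    using compactin_imp_closedin by fastforce
qed

lemma closedin_weak_star_topology:
  assumes "closed F"
  shows "closedin (weak_star_topology sY) {u \<in> dual_space sY. blinfun_apply u \<in> F}"
proof -
  have top: "topspace (weak_star_topology sY) = dual_space sY"
    by (simp add: weak_star_topology_def topspace_pullback_topology)
  have "dual_space sY - {u \<in> dual_space sY. blinfun_apply u \<in> F}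
      = blinfun_apply -` (- F) \<inter> dual_space sY"
    by auto
  then show ?thesis
    unfolding closedin_def top
    by (auto simp: weak_star_topology_def openin_pullback_topology intro!: exI[of _ "- F"] assms)
qed

subsection \<open>Spaces with a separating dual\<close>

lemma (in normed_space_over) bounded_linear_scale_left: "bounded_linear (\<lambda>a. scale a v)"
proof (rule bounded_linear_intro)
  show "scale (r *\<^sub>R a) v = r *\<^sub>R scale a v" for r a
    by (simp only: scaleR_conv_of_real[of r a] scale_scale[symmetric] scale_of_real)
qed (auto simp: norm_scale scale_left_distrib)

lemma (in normed_space_over) real_subspace:
  "subspace M \<Longrightarrow> real_vector.subspace M"
  by (metis real_vector.subspace_def scale_of_real subspace_def)

lemma (in normed_space_over) Blinfun_in_dual_space:
  assumes "\<And>x y. f (x + y) = f x + f y" "\<And>a x. f (scale a x) = a * f x"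
    and "\<And>x. norm (f x) \<le> norm x * K"
  shows "Blinfun f \<in> dual_space scale" "blinfun_apply (Blinfun f) = f"
proof -
  have "f (r *\<^sub>R x) = r *\<^sub>R f x" for r x
    using assms(2)[of "of_real r" x] by (simp add: scale_of_real scaleR_conv_of_real)
  then have "bounded_linear f"
    using assms by (intro bounded_linear_intro)
  then show "blinfun_apply (Blinfun f) = f"
    by (rule bounded_linear_Blinfun_apply)
  then show "Blinfun f \<in> dual_space scale"
    by (simp add: dual_space_def assms(2))
qed

text \<open>Separation of points from closed subspaces is isolated as an axiom because its proof
  depends on the scalar field; the construction of the operator is then carried out once for both
  fields.\<close>

locale separating_dual = normed_space_over scale
  for scale :: "'k::{real_normed_field,banach,heine_borel} \<Rightarrow> 'v::real_normed_vector \<Rightarrow> 'v" +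
  assumes separate_point: "subspace M \<Longrightarrow> closed M \<Longrightarrow> y \<notin> M \<Longrightarrow>
    \<exists>f\<in>dual_space scale. (\<forall>x\<in>M. blinfun_apply f x = 0) \<and> blinfun_apply f y \<noteq> 0"
begin

text \<open>If \<open>f\<close> vanishes on the closed space \<open>span S\<close> and not at \<open>y\<close>, then the span of \<open>insert y S\<close>
  is the preimage of \<open>span S\<close> under the continuous projection \<open>x - (f x / f y) y\<close>.\<close>

lemma closed_span_insert:
  assumes "closed (span S)"
  shows "closed (span (insert y S))"
proof (cases "y \<in> span S")
  case True
  then show ?thesis
    using assms by (simp add: span_redundant)
next
  case False
  then obtain f where f: "f \<in> dual_space scale" "\<And>x. x \<in> span S \<Longrightarrow> blinfun_apply f x = 0"
    "blinfun_apply f y \<noteq> 0"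
    using separate_point[OF subspace_span assms] by blast
  let ?P = "\<lambda>x. x - scale (blinfun_apply f x / blinfun_apply f y) y"
  \<comment> \<open>Since \<open>f\<close> annihilates \<open>span S\<close>, the coefficient of
    \<open>y\<close> is determined by \<open>x\<close>, which removes the existential quantifier
    from \<open>span_insert\<close>.\<close>
  have "c = blinfun_apply f x / blinfun_apply f y" if "x - scale c y \<in> span S" for x c
    using f(2)[OF that] f(1,3) by (simp add: blinfun.diff_right dual_space_def field_simps)
  then have "span (insert y S) = ?P -` span S"
    by (auto simp: span_insert)
  moreover have "continuous_on UNIV ?P"
    by (intro continuous_intros bounded_linear.continuous_on[OF bounded_linear_scale_left])
      (use f in auto)
  ultimately show ?thesis
    using assms by (simp add: closed_vimage)
qed

lemma closed_span_finite:
  assumes "finite S"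
  shows "closed (span S)"
  using assms by induction (auto intro: closed_span_insert)

text \<open>The span of a finite set is closed, so some functional separates a point outside from
  it; dividing by its norm keeps it in the dual.\<close>

lemma normalized_annihilator:
  assumes "finite S" "span S \<noteq> UNIV"
  obtains f where "f \<in> dual_space scale" "norm f = 1" "\<And>x. x \<in> S \<Longrightarrow> blinfun_apply f x = 0"
proof -
  obtain y where "y \<notin> span S"
    using assms(2) by blast
  then obtain f where f: "f \<in> dual_space scale" "\<And>x. x \<in> span S \<Longrightarrow> blinfun_apply f x = 0"
    "blinfun_apply f y \<noteq> 0"
    using separate_point[OF subspace_span closed_span_finite[OF assms(1)]] by blast
  then have "norm f \<noteq> 0"
    by auto
  with f show thesis
    by (intro that[of "inverse (norm f) *\<^sub>R f"])
      (auto simp: dual_space_def blinfun.scaleR_left span_base)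
qed

section \<open>A weak-star null sequence and the resulting counterexample operator\<close>

lemma weak_star_null_sequence_exists:
  assumes sep: "separable_space (euclidean :: 'v topology)"
    and inf: "\<And>B. \<not> finite_dimensional_vector_space scale B"
  obtains f where "\<And>n. f n \<in> dual_space scale" "\<And>n::nat. norm (f n) = 1"
    "\<And>y. (\<lambda>n. blinfun_apply (f n) y) \<longlonglongrightarrow> 0"
proof -
  \<comment> \<open>A finite spanning set would contain a maximal independent subset, and that would
    be a finite basis.\<close>
  have span: "span S \<noteq> UNIV" if "finite S" for S
  proof
    assume S: "span S = UNIV"
    obtain B where B: "B \<subseteq> S" "independent B" "S \<subseteq> span B"
      by (rule maximal_independent_subset)
    then have "span B = UNIV"
      using S span_minimal[OF B(3) subspace_span] by auto
    then have "finite_dimensional_vector_space scale B"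
      using B finite_subset[OF B(1) that] by unfold_locales auto
    with inf show False by blast
  qed
  obtain C :: "'v set" where C: "countable C" "closure C = UNIV"
    using sep by (auto simp: separable_space_def)
  then have "C \<noteq> {}" by auto
  define d where "d = from_nat_into C"
  have range_d: "range d = C"
    unfolding d_def using C(1) \<open>C \<noteq> {}\<close> by (rule range_from_nat_into[rotated])
  have "\<exists>g. g \<in> dual_space scale \<and> norm g = 1 \<and> (\<forall>k<n. blinfun_apply g (d k) = 0)" for n
    using normalized_annihilator[of "d ` {..<n}"] span[of "d ` {..<n}"]
    by (metis finite_imageI finite_lessThan imageI lessThan_iff)
  then obtain f where f: "\<And>n. f n \<in> dual_space scale" "\<And>n. norm (f n) = 1"
    "\<And>n k. k < n \<Longrightarrow> blinfun_apply (f n) (d k) = 0"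
    by metis
  have "(\<lambda>n. blinfun_apply (f n) y) \<longlonglongrightarrow> 0" for y
  proof (rule LIMSEQ_I)
    fix e :: real assume "e > 0"
    moreover have "y \<in> closure C" using C by simp
    ultimately obtain k where k: "dist (d k) y < e"
      unfolding closure_approachable range_d[symmetric] by auto
    \<comment> \<open>From index \<open>Suc k\<close> on, \<open>f n\<close> kills
      \<open>d k\<close>; having norm 1, it is then bounded at \<open>y\<close> by the distance to
      \<open>d k\<close>.\<close>
    have "norm (blinfun_apply (f n) y - 0) < e" if "n \<ge> Suc k" for n
    proof -
      have "blinfun_apply (f n) y = blinfun_apply (f n) (y - d k)"
        using f(3)[of k n] that by (simp add: blinfun.diff_right)
      also have "norm \<dots> \<le> norm (y - d k)"
        using norm_blinfun[of "f n" "y - d k"] f(2) by simp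
      finally show ?thesis
        using k by (simp add: dist_norm norm_minus_commute)
    qed
    then show "\<exists>N. \<forall>n\<ge>N. norm (blinfun_apply (f n) y - 0) < e" by blast
  qed
  with f show thesis by (intro that)
qed

lemma wstar_QNA_neq_operators:
  assumes "separable_space (euclidean :: 'v topology)"
    and "\<And>B. \<not> finite_dimensional_vector_space scale B"
  shows "wstar_QNA ell1_scale scale \<noteq> operators_into_dual ell1_scale scale"
proof -
  obtain f where f: "\<And>n. f n \<in> dual_space scale" "\<And>n::nat. norm (f n) = 1"
    "\<And>y. (\<lambda>n. blinfun_apply (f n) y) \<longlonglongrightarrow> 0"
    using weak_star_null_sequence_exists[OF assms] by blast
  \<comment> \<open>The weights stay strictly below 1, which prevents attainment, but tend to 1,
    which keeps the norm of \<open>T\<close> equal to 1.\<close>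
  define c where "c n = 1 - inverse (real (Suc n))" for n
  have c: "0 \<le> c n" "c n < 1" for n
    by (auto simp: c_def field_simps)
  define g where "g n = c n *\<^sub>R f n" for n
  have g_dual: "g n \<in> dual_space scale" for n
    using f(1)[of n] by (simp add: g_def dual_space_def blinfun.scaleR_left)
  have g_norm: "norm (g n) = c n" for n
    using c[of n] by (simp add: g_def f(2))
  have g_null: "(\<lambda>n. blinfun_apply (g n) y) \<longlonglongrightarrow> 0" for y
  proof (rule Lim_null_comparison[OF always_eventually])
    show "\<forall>n. norm (blinfun_apply (g n) y) \<le> norm (blinfun_apply (f n) y)"
      using c by (auto simp: g_def blinfun.scaleR_left less_imp_le intro!: mult_left_le_one_le)
    show "(\<lambda>n. norm (blinfun_apply (f n) y)) \<longlonglongrightarrow> 0"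
      using f(3) by (rule tendsto_norm_zero)
  qed
  obtain T where T: "T \<in> operators_into_dual ell1_scale scale" "norm T \<le> 1"
    "\<And>x y. blinfun_apply (blinfun_apply T x) y = (\<Sum>n. ell1_nth x n * blinfun_apply (g n) y)"
    using ell1_operator_exists[of g scale 1] g_dual g_norm c by (metis less_imp_le)
  have T_unit: "blinfun_apply T (ell1_unit n) = g n" for n
  proof (rule blinfun_eqI)
    fix y
    show "blinfun_apply (blinfun_apply T (ell1_unit n)) y = blinfun_apply (g n) y"
      unfolding T(3) by (subst suminf_finite[of "{n}"]) (auto simp: ell1_unit.rep_eq)
  qed
  \<comment> \<open>Testing on unit vectors gives every \<open>c n\<close> as a lower bound, hence
    also their limit 1.\<close>
  have "c n \<le> norm T" for n
    using norm_blinfun[of T "ell1_unit n"] by (simp add: T_unit g_norm)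
  moreover have "c \<longlonglongrightarrow> 1 - 0"
    unfolding c_def by (intro tendsto_intros LIMSEQ_inverse_real_of_nat)
  ultimately have "1 \<le> norm T"
    using LIMSEQ_le_const2[of c "1 - 0" "norm T"] by auto
  with T(2) have T_norm: "norm T = 1" by simp
  let ?K = "{u \<in> dual_space scale. blinfun_apply u \<in>
    (\<lambda>a y. \<Sum>n. a n * blinfun_apply (g n) y) ` ell1_ball}"
  have closure: "weak_star_topology scale closure_of (blinfun_apply T ` cball 0 1) \<subseteq> ?K"
  proof (rule closure_of_minimal)
    show "blinfun_apply T ` cball 0 1 \<subseteq> ?K"
    proof (intro image_subsetI CollectI conjI)
      fix x :: "'k ell1" assume "x \<in> cball 0 1"
      then have "ell1_nth x \<in> ell1_ball"
        by (intro ell1_nth_in_ell1_ball) simp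
      then show "blinfun_apply (blinfun_apply T x) \<in>
          (\<lambda>a y. \<Sum>n. a n * blinfun_apply (g n) y) ` ell1_ball"
        by (intro image_eqI[of _ _ "ell1_nth x"]) (auto simp: T(3))
      show "blinfun_apply T x \<in> dual_space scale"
        using T(1) by (simp add: operators_into_dual_def)
    qed
    show "closedin (weak_star_topology scale) ?K"
      by (intro closedin_weak_star_topology closed_null_sequence_combinations g_null)
  qed
  have "norm u < 1" if u: "u \<in> ?K" for u
  proof -
    obtain a where a: "a \<in> ell1_ball" "blinfun_apply u = (\<lambda>y. \<Sum>n. a n * blinfun_apply (g n) y)"
      using u by blast
    note sa = ell1_ball_summable[OF a(1)]
    have sac: "summable (\<lambda>n. norm (a n) * c n)"
      by (rule summable_comparison_test'[OF sa])
        (use c in \<open>auto simp: mult_left_le less_imp_le\<close>)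
    have le: "norm u \<le> (\<Sum>n. norm (a n) * c n)"
    proof (rule norm_blinfun_bound)
      show "0 \<le> (\<Sum>n. norm (a n) * c n)"
        by (intro suminf_nonneg sac mult_nonneg_nonneg c norm_ge_zero)
      fix y
      have term_le: "norm (a n * blinfun_apply (g n) y) \<le> norm (a n) * c n * norm y" for n
        using norm_blinfun[of "g n" y] by (simp add: norm_mult g_norm mult.assoc mult_left_mono)
      have summ: "summable (\<lambda>n. norm (a n * blinfun_apply (g n) y))"
        by (rule summable_comparison_test'[OF summable_mult2[OF sac, of "norm y"]])
          (use term_le in auto)
      have "norm (blinfun_apply u y) \<le> (\<Sum>n. norm (a n * blinfun_apply (g n) y))"
        unfolding a(2) by (rule summable_norm[OF summ])
      also have "\<dots> \<le> (\<Sum>n. norm (a n) * c n * norm y)"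
        by (intro suminf_le term_le summ summable_mult2 sac)
      also have "\<dots> = (\<Sum>n. norm (a n) * c n) * norm y"
        by (rule suminf_mult2[symmetric, OF sac])
      finally show "norm (blinfun_apply u y) \<le> (\<Sum>n. norm (a n) * c n) * norm y" .
    qed
    \<comment> \<open>If \<open>a\<close> is zero, the bound \<open>le\<close> already gives norm 0.
      Otherwise a nonzero coefficient \<open>a m\<close> loses a positive amount because
      \<open>c m < 1\<close>, so the weighted sum is strictly below the mass of
      \<open>a\<close>.\<close>
    show ?thesis
    proof (cases "\<forall>n. a n = 0")
      case True
      then show ?thesis using le by simp
    next
      case False
      then obtain m where "a m \<noteq> 0" by blast
      then have "0 < norm (a m) - norm (a m) * c m"
        using c[of m] by (simp add: mult_less_cancel_left2)
      moreover have "0 \<le> norm (a n) - norm (a n) * c n" for n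
        using c[of n] by (simp add: mult_left_le less_imp_le)
      ultimately have "0 < (\<Sum>n. norm (a n) - norm (a n) * c n)"
        by (intro suminf_pos2 summable_diff sa sac)
      also have "\<dots> = (\<Sum>n. norm (a n)) - (\<Sum>n. norm (a n) * c n)"
        by (rule suminf_diff[symmetric, OF sa sac])
      finally show ?thesis
        using le ell1_ball_suminf_le[OF a(1)] by simp
    qed
  qed
  then have "T \<notin> wstar_QNA ell1_scale scale"
    using closure T_norm by (fastforce simp: wstar_QNA_def)
  with T(1) show ?thesis by blast
qed

end

section \<open>Separation over the real and the complex field\<close>

lemma separating_dual_real:
  fixes scale :: "real \<Rightarrow> 'v::real_normed_vector \<Rightarrow> 'v"
  assumes "normed_space_over scale"
  shows "separating_dual scale"
proof -
  interpret normed_space_over scale by fact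
  show ?thesis
  proof
    fix M y assume M: "subspace M" "closed M" "y \<notin> M"
    obtain f :: "'v \<Rightarrow> real" where f: "bounded_linear f" "\<And>x. x \<in> M \<Longrightarrow> f x = 0" "f y \<noteq> 0"
      using separate_point_closed_subspace[OF real_subspace[OF M(1)] M(2,3)] by blast
    \<comment> \<open>Over the reals \<open>of_real\<close> is the identity, so the given scalar
      multiplication is the underlying real one and \<open>f\<close> already lies in the
      dual.\<close>
    have "scale a x = a *\<^sub>R x" for a x
      using scale_of_real[of a x] by simp
    then have "Blinfun f \<in> dual_space scale"
      using f(1) by (simp add: dual_space_def bounded_linear_Blinfun_apply linear_simps)
    with f show "\<exists>f\<in>dual_space scale. (\<forall>x\<in>M. blinfun_apply f x = 0) \<and> blinfun_apply f y \<noteq> 0"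
      by (intro bexI[of _ "Blinfun f"]) (auto simp: bounded_linear_Blinfun_apply)
  qed
qed

text \<open>The standard complexification: a real functional \<open>f\<close> is the real part of
  the complex-linear \<open>F x = f x - i f (i x)\<close>. As \<open>M\<close> is a complex
  subspace, \<open>F\<close> vanishes on it together with \<open>f\<close>.\<close>

lemma separating_dual_complex:
  fixes scale :: "complex \<Rightarrow> 'v::real_normed_vector \<Rightarrow> 'v"
  assumes "normed_space_over scale"
  shows "separating_dual scale"
proof -
  interpret normed_space_over scale by fact
  show ?thesis
  proof
    fix M y assume M: "subspace M" "closed M" "y \<notin> M"
    obtain f :: "'v \<Rightarrow> real" where f: "bounded_linear f" "\<And>x. x \<in> M \<Longrightarrow> f x = 0" "f y \<noteq> 0"
      using separate_point_closed_subspace[OF real_subspace[OF M(1)] M(2,3)] by blast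
    note lin = linear_simps[OF f(1)]
    define F where "F x = Complex (f x) (- f (scale \<i> x))" for x
    have F_add: "F (x + z) = F x + F z" for x z
      by (simp add: F_def complex_eq_iff lin scale_right_distrib)
    have F_scale: "F (scale a x) = a * F x" for a x
    proof -
      \<comment> \<open>Splitting the scalar reduces complex homogeneity to real linearity; it is
        used for \<open>a\<close> and for \<open>\<i> * a\<close>.\<close>
      have decomp: "scale a z = Re a *\<^sub>R z + Im a *\<^sub>R scale \<i> z" for a z
        by (simp flip: scale_of_real add: scale_left_distrib[symmetric] complex_eq mult.commute)
      have "f (scale a x) = Re a * f x + Im a * f (scale \<i> x)"
        unfolding decomp[of a x] by (simp add: lin)
      moreover have "f (scale \<i> (scale a x)) = - Im a * f x + Re a * f (scale \<i> x)"
        unfolding scale_scale decomp[of "\<i> * a" x] by (simp add: lin)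
      ultimately show ?thesis
        by (simp add: F_def complex_eq_iff)
    qed
    obtain K where K: "\<And>x. norm (f x) \<le> norm x * K"
      using bounded_linear.bounded[OF f(1)] by blast
    \<comment> \<open>Multiplication by \<open>\<i>\<close> preserves the norm, so real and
      imaginary part each contribute at most \<open>norm x * K\<close>.\<close>
    have F_bound: "norm (F x) \<le> norm x * (2 * K)" for x
    proof -
      have "norm (F x) \<le> \<bar>f x\<bar> + \<bar>f (scale \<i> x)\<bar>"
        using cmod_le[of "F x"] by (simp add: F_def)
      also have "\<dots> \<le> norm x * (2 * K)"
        using K[of x] K[of "scale \<i> x"] by (simp add: norm_scale)
      finally show ?thesis .
    qed
    have F: "Blinfun F \<in> dual_space scale" "blinfun_apply (Blinfun F) = F"
      by (rule Blinfun_in_dual_space[OF F_add F_scale F_bound])+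
    moreover have "F x = 0" if "x \<in> M" for x
      using that f(2) subspace_scale[OF M(1)] by (simp add: F_def complex_eq_iff)
    moreover have "F y \<noteq> 0"
      using f(3) by (simp add: F_def complex_eq_iff)
    ultimately show "\<exists>f\<in>dual_space scale. (\<forall>x\<in>M. blinfun_apply f x = 0) \<and> blinfun_apply f y \<noteq> 0"
      by (intro bexI[of _ "Blinfun F"]) auto
  qed
qed

theorem theorem4p10:
  fixes scaleYR :: "real \<Rightarrow> 'y::banach \<Rightarrow> 'y"
    and scaleYC :: "complex \<Rightarrow> 'z::banach \<Rightarrow> 'z"
  shows
    "(normed_space_over scaleYR \<and> separable_space (euclidean :: 'y topology) \<and>
      wstar_QNA (ell1_scale :: real \<Rightarrow> real ell1 \<Rightarrow> real ell1) scaleYR =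
        operators_into_dual ell1_scale scaleYR
      \<longrightarrow> (\<exists>B. finite_dimensional_vector_space scaleYR B)) \<and>
     (normed_space_over scaleYC \<and> separable_space (euclidean :: 'z topology) \<and>
      wstar_QNA (ell1_scale :: complex \<Rightarrow> complex ell1 \<Rightarrow> complex ell1) scaleYC =
        operators_into_dual ell1_scale scaleYC
      \<longrightarrow> (\<exists>B. finite_dimensional_vector_space scaleYC B))"
  using separating_dual.wstar_QNA_neq_operators[OF separating_dual_real, of scaleYR]
    separating_dual.wstar_QNA_neq_operators[OF separating_dual_complex, of scaleYC]
  by blast

end
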